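(* The following two assertions are equivalent. (A) For all $r\ge1$, $(k_1,\dots,k_r)\in\mathbb{Z}_{\ge1}^r$ and $t\in\mathbb{Z}_{\ge0}$, \[ \sum_{\substack{m_1+\cdots+m_r=r+t\\ m_i\ge1}}\ \sum_{\substack{\mathbf{a}_i\in\mathbb{Z}_{\ge1}^{m_i},\ |\mathbf{a}_i|=k_i+m_i-1\\(1\le i\le r)}}\zeta^+(\mathbf{a}_1,\dots,\mathbf{a}_r) =\sum_{l=0}^{t}\ \sum_{\substack{m_1+\cdots+m_{r-1}=t-l\\ m_i\ge0}}\ \sum_{\substack{|\mathbf{e}|=l\\ \mathbf{e}\ge0}}\zeta^+\big((k_1,\{1\}^{m_1},\dots,k_{r-1},\{1\}^{m_{r-1}},k_r)+\mathbf{e}\big), \] where for $r=1$ the right-hand side is understood as $\zeta^+(k_1+t)$. (B) For all $r\ge1$, $\mathbf{k}\in\mathbb{Z}_{\ge1}^r$ and $l\in\mathbb{Z}_{\ge0}$, \[ \sum_{\substack{|\mathbf{e}|=l\\ \mathbf{e}\ge0}}\zeta^+(\mathbf{k}+\mathbf{e})=\sum_{\substack{|\mathbf{e}'|=l\\ \mathbf{e}'\ge0}}\zeta^+\big((\mathbf{k}^\vee+\mathbf{e}')^\vee\big), \] where $\mathbf{e}$ has the depth of $\mathbf{k}$ and $\mathbf{e}'$ has the depth of $\mathbf{k}^\vee$.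
   Context: For $k_1\ge2$, $\zeta(k_1,\dots,k_r)=\sum_{n_1>\cdots>n_r\ge1}n_1^{-k_1}\cdots n_r^{-k_r}$, and for $(k_1,\dots,k_r)\in\mathbb{Z}_{\ge1}^r$, $\zeta^+(k_1,\dots,k_r):=\zeta(k_1+1,k_2,\dots,k_r)$. For a tuple $\mathbf{k}$, $|\mathbf{k}|$ is the sum of its entries and its depth its length; $(\mathbf{a}_1,\dots,\mathbf{a}_r)$ is concatenation; $\mathbf{k}+\mathbf{e}$ is componentwise addition of tuples of equal depth; $\mathbf{e}\ge0$ means all components are non-negative integers; $\{1\}^m$ is $m$ entries equal to $1$. Hoffman's dual: for $\mathbf{k}=(k_1,\dots,k_r)$ of weight $n$, let $S(\mathbf{k})=\{k_1,k_1+k_2,\dots,k_1+\cdots+k_{r-1}\}\subseteq\{1,\dots,n-1\}$; then $\mathbf{k}^\vee$ is the unique index of weight $n$ with $S(\mathbf{k}^\vee)=\{1,\dots,n-1\}\setminus S(\mathbf{k})$. Equivalently, writing $\mathbf{k}=(\underbrace{1+\cdots+1}_{k_1},\dots,\underbrace{1+\cdots+1}_{k_r})$, $\mathbf{k}^\vee$ is obtained by exchanging the symbols "$+$" and "$,$". *)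

theory Defs
  imports "HOL-Analysis.Analysis"
begin

text \<open>Indices are lists of positive integers; the weight is \<^const>\<open>sum_list\<close> and the depth
  is \<^const>\<open>length\<close>.\<close>

definition index :: "nat list \<Rightarrow> bool" where
  "index ks \<longleftrightarrow> (\<forall>k\<in>set ks. 1 \<le> k)"

text \<open>The series is the unordered sum over all strictly decreasing tuples; its terms are
  nonnegative, and it converges when the first entry is at least 2.\<close>

definition mzv :: "nat list \<Rightarrow> real" where
  "mzv ks = (\<Sum>\<^sub>\<infinity>ns \<in> {ns. length ns = length ks \<and> sorted_wrt (>) ns \<and> (\<forall>n\<in>set ns. 1 \<le> n)}.
     \<Prod>i<length ks. 1 / real (ns ! i) ^ (ks ! i))"

definition mzv_plus :: "nat list \<Rightarrow> real" where
  "mzv_plus ks = mzv ((hd ks + 1) # tl ks)"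

definition weak_compositions :: "nat \<Rightarrow> nat \<Rightarrow> nat list set" where
  "weak_compositions d n = {es. length es = d \<and> sum_list es = n}"

definition compositions :: "nat \<Rightarrow> nat \<Rightarrow> nat list set" where
  "compositions d n = {ms. index ms \<and> length ms = d \<and> sum_list ms = n}"

definition tuple_add :: "nat list \<Rightarrow> nat list \<Rightarrow> nat list" where
  "tuple_add ks es = map2 (+) ks es"

text \<open>\<open>(k\<^sub>1, {1}\<^bsup>m\<^sub>1\<^esup>, \<dots>, k\<^bsub>r-1\<^esub>, {1}\<^bsup>m\<^bsub>r-1\<^esub>\<^esup>, k\<^sub>r)\<close>, for \<open>ms\<close> of length \<open>r - 1\<close>\<close>

definition insert_ones :: "nat list \<Rightarrow> nat list \<Rightarrow> nat list" where
  "insert_ones ks ms = concat (map2 (\<lambda>k m. k # replicate m 1) (butlast ks) ms) @ [last ks]"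

definition partial_sums :: "nat list \<Rightarrow> nat set" where
  "partial_sums ks = {sum_list (take j ks) | j. 1 \<le> j \<and> j < length ks}"

definition hoffman_dual :: "nat list \<Rightarrow> nat list" where
  "hoffman_dual ks = (THE ks'. index ks' \<and> sum_list ks' = sum_list ks \<and>
     partial_sums ks' = {1..<sum_list ks} - partial_sums ks)"

lemma partial_sums_Nil [simp]: "partial_sums [] = {}"
  by (simp add: partial_sums_def)

lemma partial_sums_single [simp]: "partial_sums [k] = {}"
  by (auto simp: partial_sums_def)

lemma partial_sums_Cons:
  assumes "ks \<noteq> []"
  shows "partial_sums (k # ks) = insert k ((+) k ` partial_sums ks)"
proof (intro equalityI subsetI)
  fix x assume "x \<in> partial_sums (k # ks)"
  then obtain j where j: "1 \<le> j" "j < Suc (length ks)" "x = sum_list (take j (k # ks))"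
    by (auto simp: partial_sums_def)
  then obtain i where i: "j = Suc i" by (cases j) auto
  show "x \<in> insert k ((+) k ` partial_sums ks)"
  proof (cases "i = 0")
    case False
    then have "sum_list (take i ks) \<in> partial_sums ks"
      using i j by (auto simp: partial_sums_def intro!: exI[of _ i])
    then show ?thesis using i j by auto
  qed (use i j in auto)
next
  fix x assume "x \<in> insert k ((+) k ` partial_sums ks)"
  then consider "x = k" | j where "1 \<le> j" "j < length ks" "x = k + sum_list (take j ks)"
    by (auto simp: partial_sums_def)
  then show "x \<in> partial_sums (k # ks)"
  proof cases
    case 1
    then show ?thesis using assms by (auto simp: partial_sums_def intro!: exI[of _ "Suc 0"])
  next
    case (2 j)
    then show ?thesis by (auto simp: partial_sums_def intro!: exI[of _ "Suc j"])
  qed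
qed

lemma index_partial_sums_exists:
  assumes "T \<subseteq> {1..<n}"
  shows "\<exists>ks. index ks \<and> sum_list ks = n \<and> partial_sums ks = T"
  using assms
proof (induction n arbitrary: T rule: less_induct)
  case (less n)
  show ?case
  proof (cases "T = {}")
    case True
    show ?thesis
    proof (cases "n = 0")
      case True
      with \<open>T = {}\<close> show ?thesis by (intro exI[of _ "[]"]) (auto simp: index_def)
    next
      case False
      with \<open>T = {}\<close> show ?thesis by (intro exI[of _ "[n]"]) (auto simp: index_def)
    qed
  next
    case False
    define a where "a = Min T"
    have fin: "finite T" using less.prems finite_subset by blast
    have aT: "a \<in> T" and amin: "\<And>x. x \<in> T \<Longrightarrow> a \<le> x"
      using fin False by (auto simp: a_def)
    have a: "1 \<le> a" "a < n" using aT less.prems by auto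
    define T' where "T' = (\<lambda>x. x - a) ` (T - {a})"
    have "T' \<subseteq> {1..<n - a}"
      using less.prems amin by (force simp: T'_def)
    moreover have "n - a < n" using a by simp
    ultimately obtain ks where ks: "index ks" "sum_list ks = n - a" "partial_sums ks = T'"
      using less.IH by blast
    have "ks \<noteq> []" using ks a by auto
    moreover have "(+) a ` T' = T - {a}"
      using amin by (force simp: T'_def image_image)
    ultimately have "partial_sums (a # ks) = T"
      using ks aT by (auto simp: partial_sums_Cons)
    then show ?thesis using ks a by (intro exI[of _ "a # ks"]) (auto simp: index_def)
  qed
qed

lemma partial_sums_pos: "index ks \<Longrightarrow> x \<in> partial_sums ks \<Longrightarrow> 1 \<le> x"
proof (induction ks arbitrary: x)
  case (Cons k ks)
  then show ?case by (cases "ks = []") (auto simp: partial_sums_Cons index_def)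
qed simp

lemma index_partial_sums_unique:
  assumes "index ks" "index ks'" "sum_list ks = sum_list ks'" "partial_sums ks = partial_sums ks'"
  shows "ks = ks'"
  using assms
proof (induction ks arbitrary: ks')
  case Nil
  then show ?case by (cases ks') (auto simp: index_def)
next
  case (Cons k ks)
  obtain k' ls where ks': "ks' = k' # ls"
    using Cons.prems by (cases ks') (auto simp: index_def)
  have idx: "index ks" "index ls" using Cons.prems ks' by (auto simp: index_def)
  show ?case
  proof (cases "ks = [] \<or> ls = []")
    case True
    then show ?thesis using Cons.prems ks' by (cases "ks = []"; cases "ls = []") (auto simp: partial_sums_Cons)
  next
    case False
    then have eq: "insert k ((+) k ` partial_sums ks) = insert k' ((+) k' ` partial_sums ls)"
      using Cons.prems ks' by (simp add: partial_sums_Cons)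
    have "k \<in> insert k' ((+) k' ` partial_sums ls)" "k' \<in> insert k ((+) k ` partial_sums ks)"
      using eq by blast+
    then have "k = k'" by auto
    have "k \<notin> (+) k ` partial_sums ks" "k \<notin> (+) k ` partial_sums ls"
      using partial_sums_pos idx by fastforce+
    then have "(+) k ` partial_sums ks = (+) k ` partial_sums ls"
      using eq \<open>k = k'\<close> by (simp add: insert_ident)
    then have "partial_sums ks = partial_sums ls"
      by (simp add: inj_image_eq_iff)
    then show ?thesis using Cons.IH[of ls] Cons.prems idx ks' \<open>k = k'\<close> by simp
  qed
qed

lemma hoffman_dual_ex1:
  "\<exists>!ks'. index ks' \<and> sum_list ks' = sum_list ks \<and>
     partial_sums ks' = {1..<sum_list ks} - partial_sums ks"
  using index_partial_sums_exists[of "{1..<sum_list ks} - partial_sums ks" "sum_list ks"]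
    index_partial_sums_unique by (metis Diff_subset)

lemma hoffman_dual:
  shows index_hoffman_dual: "index (hoffman_dual ks)"
    and sum_list_hoffman_dual: "sum_list (hoffman_dual ks) = sum_list ks"
    and partial_sums_hoffman_dual:
      "partial_sums (hoffman_dual ks) = {1..<sum_list ks} - partial_sums ks"
  using theI'[OF hoffman_dual_ex1[of ks]] unfolding hoffman_dual_def by auto

text \<open>In depth 1 the sum over \<open>ms\<close> is empty unless \<open>l = t\<close>, where it runs over the empty tuple
  only; this is the usual convention for the right-hand side.\<close>

lemma insert_ones_sum_depth_1:
  "(\<Sum>l=0..t. \<Sum>ms\<in>weak_compositions (length [k] - 1) (t - l).
      \<Sum>es\<in>weak_compositions (length (insert_ones [k] ms)) l.
        mzv_plus (tuple_add (insert_ones [k] ms) es)) = mzv_plus [k + t]"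
proof -
  have *: "weak_compositions 0 n = (if n = 0 then {[]} else {})" for n
    by (auto simp: weak_compositions_def)
  have **: "weak_compositions (Suc 0) n = {[n]}" for n
    by (auto simp: weak_compositions_def length_Suc_conv)
  have "(\<Sum>l=0..t. \<Sum>ms\<in>weak_compositions (length [k] - 1) (t - l).
      \<Sum>es\<in>weak_compositions (length (insert_ones [k] ms)) l.
        mzv_plus (tuple_add (insert_ones [k] ms) es))
    = (\<Sum>l=0..t. if l = t then mzv_plus [k + t] else 0)"
    by (intro sum.cong refl) (auto simp: * ** insert_ones_def tuple_add_def)
  then show ?thesis by simp
qed

end

theory Submission
  imports Defs
begin

text \<open>Write an index of weight \<open>n\<close> as a word of length \<open>n - 1\<close> in the letters \<open>x\<close> (for ``+'') and
  \<open>y\<close> (for ``,''), so that Hoffman's dual exchanges \<open>x\<close> and \<open>y\<close>. With a formal parameter \<open>T\<close>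
  recording the number of inserted letters, let \<open>\<phi>\<close> be the substitution
  \<open>y \<mapsto> y (1 - y T)\<^sup>-\<^sup>1\<close>, let \<open>O\<close> be the substitution \<open>y \<mapsto> y (1 - x T)\<^sup>-\<^sup>1\<close> followed by left
  multiplication with \<open>(1 - x T)\<^sup>-\<^sup>1\<close>, and let \<open>D\<close> be the conjugate of \<open>O\<close> under duality.
  The two sides of (B) are \<open>O\<close> and \<open>D\<close>. The right-hand side of (A) is \<open>O \<circ> \<phi>\<close>, and the left-hand
  side inserts powers of \<open>y\<close> at every place of the word, which is \<open>D \<circ> \<phi>\<close> because
  \<open>y\<close> commutes with \<open>(1 - y T)\<^sup>-\<^sup>1\<close>. So (B) implies (A), and as \<open>\<phi>\<close> is the
  identity modulo \<open>T\<close>, the converse follows by induction on the power of \<open>T\<close>.\<close>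

section \<open>Words and indices\<close>

text \<open>\<open>True\<close> is the letter ``+'' and \<open>False\<close> the letter ``,''.\<close>

fun index_of_word :: "bool list \<Rightarrow> nat list" where
  "index_of_word [] = [1]"
| "index_of_word (False # w) = 1 # index_of_word w"
| "index_of_word (True # w) = Suc (hd (index_of_word w)) # tl (index_of_word w)"

lemma index_of_word_not_Nil [simp]: "index_of_word w \<noteq> []"
  by (induction w rule: index_of_word.induct) auto

lemma index_of_word_True:
  "index_of_word w = k # ks \<Longrightarrow> index_of_word (True # w) = Suc k # ks"
  by simp

lemma index_index_of_word: "index (index_of_word w)"
proof (induction w rule: index_of_word.induct)
  case (3 w)
  then show ?case by (cases "index_of_word w") (auto simp: index_def)
qed (auto simp: index_def)

lemma sum_list_index_of_word: "sum_list (index_of_word w) = Suc (length w)"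
proof (induction w rule: index_of_word.induct)
  case (3 w)
  then show ?case by (cases "index_of_word w") auto
qed auto

text \<open>Carries identities proved for words over to every nonempty index. A comma prepends the
  entry 1, and plus letters then raise it to any positive value.\<close>

lemma ex_index_of_word:
  assumes "index ks" "ks \<noteq> []"
  shows "\<exists>w. index_of_word w = ks"
proof -
  have "\<exists>w. index_of_word w = Suc k # js" if "\<exists>w. index_of_word w = 1 # js" for k js
  proof (induction k)
    case (Suc k)
    then show ?case using index_of_word_True by blast
  qed (use that in simp)
  then have step: "\<exists>w. index_of_word w = k # js" if "\<exists>w. index_of_word w = 1 # js" "1 \<le> k" for k js
    using that by (metis Suc_le_D One_nat_def)
  show ?thesis
    using assms
  proof (induction ks)
    case (Cons k ks)
    have "\<exists>w. index_of_word w = 1 # ks"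
    proof (cases "ks = []")
      case True
      then show ?thesis using index_of_word.simps(1) by blast
    next
      case False
      then show ?thesis using Cons index_of_word.simps(2) by (fastforce simp: index_def)
    qed
    then show ?case using Cons.prems step by (auto simp: index_def)
  qed simp
qed

lemma partial_sums_Suc_Cons: "partial_sums (Suc k # ks) = Suc ` partial_sums (k # ks)"
  by (cases "ks = []") (auto simp: partial_sums_Cons image_image)

text \<open>The letter at position \<open>i\<close> sits between the units \<open>i + 1\<close> and
  \<open>i + 2\<close> of the weight, so it is a comma exactly when \<open>Suc i\<close> is a
  partial sum.\<close>

lemma partial_sums_index_of_word:
  "partial_sums (index_of_word w) = {Suc i | i. i < length w \<and> \<not> w ! i}"
proof (induction w)
  case (Cons a w)
  have split: "{Suc i | i. i < length (a # w) \<and> \<not> (a # w) ! i} =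
      (if a then {} else {1}) \<union> Suc ` {Suc i | i. i < length w \<and> \<not> w ! i}" (is "?S = ?R")
  proof
    show "?S \<subseteq> ?R"
    proof
      fix z assume "z \<in> ?S"
      then obtain i where "z = Suc i" "i < length (a # w)" "\<not> (a # w) ! i" by blast
      then show "z \<in> ?R" by (cases i) auto
    qed
    show "?R \<subseteq> ?S" by (force split: if_splits)
  qed
  obtain k ks where k: "index_of_word w = k # ks" by (cases "index_of_word w") auto
  show ?case
  proof (cases a)
    case True
    then show ?thesis using Cons.IH split index_of_word_True[OF k] k
      by (simp add: partial_sums_Suc_Cons)
  next
    case False
    then show ?thesis using Cons.IH split by (simp add: partial_sums_Cons plus_1_eq_Suc)
  qed
qed simp

text \<open>Negating the letters complements the set of comma positions, and an index is determined
  by its weight and its partial sums.\<close>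

lemma hoffman_dual_index_of_word:
  "hoffman_dual (index_of_word w) = index_of_word (map Not w)"
proof (rule index_partial_sums_unique)
  show "partial_sums (hoffman_dual (index_of_word w)) = partial_sums (index_of_word (map Not w))"
    unfolding partial_sums_hoffman_dual partial_sums_index_of_word sum_list_index_of_word
    by (auto simp: Suc_le_eq gr0_conv_Suc)
qed (simp_all add: hoffman_dual index_index_of_word sum_list_index_of_word)

lemma index_of_word_replicate_False_append:
  "index_of_word (replicate j False @ w) = replicate j 1 @ index_of_word w"
  by (induction j) auto

lemma index_of_word_replicate_True_append:
  "index_of_word (replicate j True @ w) = (hd (index_of_word w) + j) # tl (index_of_word w)"
  by (induction j) auto

section \<open>Summing over weak compositions and compositions\<close>

lemma sum_triangle_shift:
  fixes g :: "nat \<Rightarrow> nat \<Rightarrow> 'a :: comm_monoid_add"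
  shows "(\<Sum>j\<le>t. \<Sum>i\<le>j. g i j) = (\<Sum>i\<le>t. \<Sum>j\<le>t - i. g i (i + j))"
proof -
  have "(\<Sum>j\<le>t. \<Sum>i\<le>j. g i j) = (\<Sum>(j, i)\<in>Sigma {..t} (\<lambda>j. {..j}). g i j)"
    by (rule sum.Sigma) auto
  also have "\<dots> = (\<Sum>(i, j)\<in>Sigma {..t} (\<lambda>i. {..t - i}). g i (i + j))"
    by (rule sum.reindex_bij_witness[of _ "\<lambda>(i, j). (i + j, i)" "\<lambda>(j, i). (i, j - i)"]) auto
  also have "\<dots> = (\<Sum>i\<le>t. \<Sum>j\<le>t - i. g i (i + j))"
    by (rule sum.Sigma[symmetric]) auto
  finally show ?thesis .
qed

lemma weak_compositions_0: "weak_compositions 0 n = (if n = 0 then {[]} else {})"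
  by (auto simp: weak_compositions_def)

lemma weak_compositions_zero_sum: "weak_compositions d 0 = {replicate d 0}"
  by (auto simp: weak_compositions_def intro!: replicate_eqI)

lemma weak_compositions_Suc:
  "weak_compositions (Suc d) n = (\<Union>j\<le>n. (#) j ` weak_compositions d (n - j))"
proof
  show "weak_compositions (Suc d) n \<subseteq> (\<Union>j\<le>n. (#) j ` weak_compositions d (n - j))"
  proof
    fix z assume "z \<in> weak_compositions (Suc d) n"
    then obtain j es where "z = j # es" "length es = d" "j + sum_list es = n"
      by (auto simp: weak_compositions_def length_Suc_conv)
    then show "z \<in> (\<Union>j\<le>n. (#) j ` weak_compositions d (n - j))"
      by (intro UN_I[of j]) (auto simp: weak_compositions_def)
  qed
qed (auto simp: weak_compositions_def)

lemma finite_weak_compositions [simp]: "finite (weak_compositions d n)"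
  by (induction d arbitrary: n) (auto simp: weak_compositions_0 weak_compositions_Suc)

lemma sum_weak_compositions_Suc:
  "(\<Sum>es\<in>weak_compositions (Suc d) n. f es) =
     (\<Sum>j\<le>n. \<Sum>es\<in>weak_compositions d (n - j). f (j # es))"
  unfolding weak_compositions_Suc
  by (subst sum.UNION_disjoint) (auto simp: sum.reindex)

lemma compositions_eq_empty:
  assumes "n < d"
  shows "compositions d n = {}"
proof -
  have "length ms \<le> sum_list ms" if "index ms" for ms
    using that by (induction ms) (auto simp: index_def)
  then show ?thesis using assms by (force simp: compositions_def)
qed

lemma compositions_0: "compositions 0 n = (if n = 0 then {[]} else {})"
  by (auto simp: compositions_def index_def)

lemma compositions_Suc:
  "compositions (Suc d) n = (\<Union>j<n. (#) (Suc j) ` compositions d (n - Suc j))"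
proof
  show "compositions (Suc d) n \<subseteq> (\<Union>j<n. (#) (Suc j) ` compositions d (n - Suc j))"
  proof
    fix z assume "z \<in> compositions (Suc d) n"
    then obtain k ks where "z = Suc k # ks" "index ks" "length ks = d" "Suc k + sum_list ks = n"
      by (auto simp: compositions_def length_Suc_conv index_def Suc_le_eq gr0_conv_Suc)
    then show "z \<in> (\<Union>j<n. (#) (Suc j) ` compositions d (n - Suc j))"
      by (intro UN_I[of k]) (auto simp: compositions_def)
  qed
qed (auto simp: compositions_def index_def)

lemma finite_compositions [simp]: "finite (compositions d n)"
  by (induction d arbitrary: n) (auto simp: compositions_0 compositions_Suc)

lemma sum_compositions_Suc:
  "(\<Sum>ms\<in>compositions (Suc d) (Suc d + t). f ms) =
     (\<Sum>j\<le>t. \<Sum>ms\<in>compositions d (d + (t - j)). f (Suc j # ms))"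
proof -
  have "(\<Sum>ms\<in>compositions (Suc d) (Suc d + t). f ms) =
      (\<Sum>j<Suc d + t. \<Sum>ms\<in>compositions d (Suc d + t - Suc j). f (Suc j # ms))"
    unfolding compositions_Suc by (subst sum.UNION_disjoint) (auto simp: sum.reindex)
  also have "\<dots> = (\<Sum>j\<le>t. \<Sum>ms\<in>compositions d (Suc d + t - Suc j). f (Suc j # ms))"
  \<comment> \<open>A first part larger than \<open>Suc t\<close> leaves too little for
    \<open>d\<close> positive parts.\<close>
  proof (rule sum.mono_neutral_right)
    show "\<forall>j\<in>{..<Suc d + t} - {..t}. (\<Sum>ms\<in>compositions d (Suc d + t - Suc j). f (Suc j # ms)) = 0"
    proof
      fix j assume "j \<in> {..<Suc d + t} - {..t}"
      then have "Suc d + t - Suc j < d" by auto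
      then show "(\<Sum>ms\<in>compositions d (Suc d + t - Suc j). f (Suc j # ms)) = 0"
        by (simp add: compositions_eq_empty)
    qed
  qed auto
  also have "\<dots> = (\<Sum>j\<le>t. \<Sum>ms\<in>compositions d (d + (t - j)). f (Suc j # ms))"
    by (rule sum.cong) auto
  finally show ?thesis .
qed

lemma compositions_all_ones: "compositions d d = {replicate d 1}"
proof (induction d)
  case (Suc d)
  have "compositions (Suc d) (Suc d) = (\<Union>j<Suc d. (#) (Suc j) ` compositions d (d - j))"
    by (simp add: compositions_Suc)
  also have "\<dots> = (#) 1 ` compositions d d"
  proof -
    have "compositions d (d - j) = {}" if "j \<noteq> 0" "j < Suc d" for j
      using that by (intro compositions_eq_empty) auto
    then show ?thesis by (auto simp: lessThan_Suc_eq_insert_0)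
  qed
  finally show ?case using Suc by simp
qed (simp add: compositions_0)

text \<open>Splits off the block of ones preceding the first entry that is at least 2.\<close>

lemma sum_compositions_leading_ones:
  assumes "1 \<le> k"
  shows "(\<Sum>a\<in>compositions (Suc j) (Suc k + j). f a) =
    (\<Sum>i\<le>j. \<Sum>a\<in>compositions (Suc (j - i)) (k + (j - i)).
       f (replicate i 1 @ Suc (hd a) # tl a))"
proof (induction j arbitrary: f)
  case 0
  \<comment> \<open>Applied to \<open>n = k\<close> this needs \<open>1 \<le> k\<close>: the single
    entry must stay positive after being lowered by 1.\<close>
  have "compositions (Suc 0) n = {[n]}" if "1 \<le> n" for n
    using that by (auto simp: compositions_def index_def length_Suc_conv)
  then show ?case using assms by simp
next
  case (Suc j)
  \<comment> \<open>\<open>?B\<close> has first entry at least 2 and gives the summand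
    \<open>i = 0\<close>; \<open>?C\<close> starts with 1 and is left to the induction
    hypothesis.\<close>
  let ?B = "(\<lambda>a. Suc (hd a) # tl a) ` compositions (Suc (Suc j)) (k + Suc j)"
  let ?C = "(#) 1 ` compositions (Suc j) (Suc k + j)"
  have split: "compositions (Suc (Suc j)) (Suc k + Suc j) = ?B \<union> ?C"
  proof
    show "compositions (Suc (Suc j)) (Suc k + Suc j) \<subseteq> ?B \<union> ?C"
    proof
      fix z assume z: "z \<in> compositions (Suc (Suc j)) (Suc k + Suc j)"
      then obtain n b where b: "z = Suc n # b"
        by (auto simp: compositions_Suc)
      show "z \<in> ?B \<union> ?C"
      proof (cases "n = 0")
        case True
        then show ?thesis using z b by (auto simp: compositions_def index_def)
      next
        case False
        then have "n # b \<in> compositions (Suc (Suc j)) (k + Suc j)"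
          using z b by (auto simp: compositions_def index_def)
        then show ?thesis using b by (force intro: rev_image_eqI)
      qed
    qed
    show "?B \<union> ?C \<subseteq> compositions (Suc (Suc j)) (Suc k + Suc j)"
      by (auto simp: compositions_def index_def length_Suc_conv)
  qed
  have disj: "?B \<inter> ?C = {}"
    by (auto simp: compositions_def index_def length_Suc_conv)
  have inj: "inj_on (\<lambda>a. Suc (hd a) # tl a) (compositions (Suc (Suc j)) (k + Suc j))"
  proof (rule inj_onI)
    fix a b
    assume "a \<in> compositions (Suc (Suc j)) (k + Suc j)" "b \<in> compositions (Suc (Suc j)) (k + Suc j)"
      and eq: "Suc (hd a) # tl a = Suc (hd b) # tl b"
    then have "a \<noteq> []" "b \<noteq> []" by (auto simp: compositions_def)
    then show "a = b" using eq by (simp add: list.expand)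
  qed
  have inj_Cons: "inj_on ((#) 1) (compositions (Suc j) (Suc k + j))"
    by simp
  have "(\<Sum>a\<in>compositions (Suc (Suc j)) (Suc k + Suc j). f a) =
      (\<Sum>a\<in>compositions (Suc (Suc j)) (k + Suc j). f (Suc (hd a) # tl a)) +
      (\<Sum>a\<in>compositions (Suc j) (Suc k + j). f (1 # a))"
    unfolding split sum.union_disjoint[OF finite_imageI finite_imageI disj, OF finite_compositions finite_compositions]
      sum.reindex[OF inj] sum.reindex[OF inj_Cons] comp_def ..
  then show ?case
    unfolding Suc.IH sum.atMost_Suc_shift by simp
qed

section \<open>Inserting letters into words\<close>

text \<open>With \<open>f\<close> extended linearly, the value at \<open>l\<close> is the coefficient of \<open>T\<^sup>l\<close> in \<open>f (O w)\<close> (for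
  \<open>c = True\<close>) and in \<open>f (D w)\<close> (for \<open>c = False\<close>); likewise \<open>repeat_commas_sum\<close> stands for \<open>\<phi>\<close>.\<close>

fun insert_before_sum :: "bool \<Rightarrow> bool list \<Rightarrow> nat \<Rightarrow> (bool list \<Rightarrow> real) \<Rightarrow> real" where
  "insert_before_sum c [] l f = f (replicate l c)"
| "insert_before_sum c (a # w) l f =
     (if a = c then insert_before_sum c w l (\<lambda>v. f (a # v))
      else \<Sum>j\<le>l. insert_before_sum c w (l - j) (\<lambda>v. f (replicate j c @ a # v)))"

fun repeat_commas_sum :: "bool list \<Rightarrow> nat \<Rightarrow> (bool list \<Rightarrow> real) \<Rightarrow> real" where
  "repeat_commas_sum [] n f = (if n = 0 then f [] else 0)"
| "repeat_commas_sum (True # w) n f = repeat_commas_sum w n (\<lambda>v. f (True # v))"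
| "repeat_commas_sum (False # w) n f =
     (\<Sum>j\<le>n. repeat_commas_sum w (n - j) (\<lambda>v. f (replicate (Suc j) False @ v)))"

text \<open>The coefficient of \<open>T^t\<close> when a factor \<open>(1 - y T)^-1\<close> is put
  before every letter, of either kind, and at the end of the word.\<close>

fun insert_commas_sum :: "bool list \<Rightarrow> nat \<Rightarrow> (bool list \<Rightarrow> real) \<Rightarrow> real" where
  "insert_commas_sum [] t f = f (replicate t False)"
| "insert_commas_sum (a # w) t f =
     (\<Sum>j\<le>t. insert_commas_sum w (t - j) (\<lambda>v. f (replicate j False @ a # v)))"

lemma repeat_commas_sum_sum:
  "repeat_commas_sum w n (\<lambda>v. \<Sum>j\<in>J. g j v) = (\<Sum>j\<in>J. repeat_commas_sum w n (g j))"
proof (induction w arbitrary: n g)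
  case (Cons a w)
  show ?case
  proof (cases a)
    case False
    then show ?thesis
      using Cons.IH[of _ "\<lambda>j v. g j (replicate (Suc i) False @ v)" for i]
      by (simp add: sum.swap[of _ J])
  qed (use Cons.IH[of _ "\<lambda>j v. g j (True # v)"] in simp)
qed auto

lemma insert_before_sum_replicate_same:
  "insert_before_sum c (replicate j c @ w) l f = insert_before_sum c w l (\<lambda>v. f (replicate j c @ v))"
  by (induction j arbitrary: f) auto

lemma insert_before_sum_dual:
  "insert_before_sum (\<not> c) (map Not w) l f = insert_before_sum c w l (\<lambda>v. f (map Not v))"
  by (induction w arbitrary: l f) auto

text \<open>Every place receives its commas from exactly one of the two maps: those next to an
  original comma come from \<phi>, those before a plus or at the end from \<open>D\<close>.\<close>

theorem insert_commas_sum_eq: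
  "insert_commas_sum w t f =
     (\<Sum>l\<le>t. repeat_commas_sum w (t - l) (\<lambda>v. insert_before_sum False v l f))"
proof (induction w arbitrary: t f)
  case Nil
  have "(\<Sum>l\<le>t. repeat_commas_sum [] (t - l) (\<lambda>v. insert_before_sum False v l f)) =
      (\<Sum>l\<le>t. if l = t then f (replicate t False) else 0)"
    by (rule sum.cong) auto
  then show ?case by simp
next
  case (Cons a w)
  show ?case
  proof (cases a)
    case True
    let ?g = "\<lambda>j v. f (replicate j False @ True # v)"
    have "(\<Sum>l\<le>t. repeat_commas_sum (a # w) (t - l) (\<lambda>v. insert_before_sum False v l f)) =
        (\<Sum>l\<le>t. \<Sum>j\<le>l. repeat_commas_sum w (t - l) (\<lambda>v. insert_before_sum False v (l - j) (?g j)))"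
      using True by (simp add: repeat_commas_sum_sum)
    also have "\<dots> = (\<Sum>j\<le>t. \<Sum>l\<le>t - j.
        repeat_commas_sum w (t - j - l) (\<lambda>v. insert_before_sum False v l (?g j)))"
      by (subst sum_triangle_shift) simp
    also have "\<dots> = insert_commas_sum (a # w) t f"
      using True by (simp add: Cons.IH)
    finally show ?thesis by simp
  next
    case False
    let ?g = "\<lambda>j v. f (replicate j False @ False # v)"
    \<comment> \<open>\<open>D\<close> passes the block of commas made by \<phi> unchanged; read as
      \<open>j\<close> new commas before the original one, it matches
      \<open>insert_commas_sum\<close>.\<close>
    have shift: "insert_before_sum False (replicate (Suc j) False @ v) l f =
        insert_before_sum False v l (?g j)" for j v l
      unfolding insert_before_sum_replicate_same by (simp add: replicate_app_Cons_same)
    have "(\<Sum>l\<le>t. repeat_commas_sum (a # w) (t - l) (\<lambda>v. insert_before_sum False v l f)) =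
        (\<Sum>l\<le>t. \<Sum>j\<le>t - l. repeat_commas_sum w (t - l - j)
           (\<lambda>v. insert_before_sum False v l (?g j)))"
      using False by (simp only: repeat_commas_sum.simps shift)
    also have "\<dots> = (\<Sum>j\<le>t. \<Sum>l\<le>t - j. repeat_commas_sum w (t - l - j)
           (\<lambda>v. insert_before_sum False v l (?g j)))"
      by (simp add: sum.Sigma, rule sum.reindex_bij_witness[of _ prod.swap prod.swap]) auto
    also have "\<dots> = insert_commas_sum (a # w) t f"
      using False by (simp add: Cons.IH add.commute)
    finally show ?thesis by simp
  qed
qed

section \<open>The sums over indices in terms of words\<close>

text \<open>An entry is a run of pluses closed by a comma or by the end of the word; adding
  \<open>j\<close> to it means inserting \<open>j\<close> pluses just before that closing
  place.\<close>

lemma sum_tuple_add_index_of_word: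
  "(\<Sum>es\<in>weak_compositions (length (index_of_word w)) l. f (tuple_add (index_of_word w) es)) =
     insert_before_sum True w l (\<lambda>v. f (index_of_word v))"
proof (induction w arbitrary: l f)
  case Nil
  have "weak_compositions (Suc 0) l = {[l]}"
    by (auto simp: weak_compositions_def length_Suc_conv)
  then show ?case
    using index_of_word_replicate_True_append[of l "[]"] by (simp add: tuple_add_def)
next
  case (Cons a w)
  show ?case
  proof (cases a)
    case True
    obtain k ks where k: "index_of_word w = k # ks" by (cases "index_of_word w") auto
    show ?thesis
      using True Cons.IH[where l = l and f = "\<lambda>ks. f (Suc (hd ks) # tl ks)"] k
      by (simp add: sum_weak_compositions_Suc tuple_add_def)
  next
    case False
    then show ?thesis
      using Cons.IH[where l = "l - j" and f = "\<lambda>ks. f (Suc j # ks)" for j]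
      by (simp add: sum_weak_compositions_Suc tuple_add_def index_of_word_replicate_True_append)
  qed
qed

text \<open>Inserting pluses into the negated word and negating back inserts commas into the
  original one.\<close>

lemma sum_hoffman_dual_index_of_word:
  "(\<Sum>es\<in>weak_compositions (length (hoffman_dual (index_of_word w))) l.
      f (hoffman_dual (tuple_add (hoffman_dual (index_of_word w)) es))) =
     insert_before_sum False w l (\<lambda>v. f (index_of_word v))"
  using sum_tuple_add_index_of_word[of "\<lambda>ks. f (hoffman_dual ks)" "map Not w" l]
    insert_before_sum_dual[of False w]
  by (simp add: hoffman_dual_index_of_word comp_def)

section \<open>The right-hand side of (A): interspersed ones\<close>

lemma insert_ones_Cons:
  "ks \<noteq> [] \<Longrightarrow> insert_ones (k # ks) (m # ms) = k # replicate m 1 @ insert_ones ks ms"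
  by (simp add: insert_ones_def)

lemma insert_ones_Suc:
  "length ms = length ks \<Longrightarrow>
    insert_ones (Suc k # ks) ms = Suc (hd (insert_ones (k # ks) ms)) # tl (insert_ones (k # ks) ms)"
  by (cases ks; cases ms) (auto simp: insert_ones_def)

text \<open>Identifies the summand \<open>l = t\<close> of (A), where no ones are inserted, with a
  side of (B).\<close>

lemma insert_ones_replicate_0:
  "ks \<noteq> [] \<Longrightarrow> insert_ones ks (replicate (length ks - 1) 0) = ks"
proof (induction ks)
  case (Cons k ks)
  then show ?case
    by (cases ks) (auto simp: insert_ones_Cons, simp add: insert_ones_def)
qed simp

lemma index_insert_ones:
  assumes "index ks" "ks \<noteq> []"
  shows "index (insert_ones ks ms)"
proof -
  have "index (concat (map2 (\<lambda>k m. k # replicate m 1) js ms))" if "index js" for js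
    using that by (induction js arbitrary: ms) (auto simp: index_def dest!: set_zip_leftD)
  moreover have "index (butlast ks)" "1 \<le> last ks"
    using assms by (auto simp: index_def dest: in_set_butlastD)
  ultimately show ?thesis by (auto simp: insert_ones_def index_def)
qed

text \<open>Following a comma by \<open>j\<close> further commas creates \<open>j\<close> entries 1
  after the entry it closes. The last entry is closed by no comma, hence the \<open>- 1\<close> in
  the length.\<close>

lemma sum_insert_ones_index_of_word:
  "(\<Sum>ms\<in>weak_compositions (length (index_of_word w) - 1) n. f (insert_ones (index_of_word w) ms)) =
     repeat_commas_sum w n (\<lambda>v. f (index_of_word v))"
proof (induction w arbitrary: n f)
  case Nil
  then show ?case by (simp add: weak_compositions_0 insert_ones_def)
next
  case (Cons a w)
  obtain k ks where k: "index_of_word w = k # ks" by (cases "index_of_word w") auto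
  show ?case
  proof (cases a)
    case True
    have "(\<Sum>ms\<in>weak_compositions (length ks) n. f (insert_ones (Suc k # ks) ms)) =
        (\<Sum>ms\<in>weak_compositions (length ks) n.
          f (Suc (hd (insert_ones (k # ks) ms)) # tl (insert_ones (k # ks) ms)))"
      by (rule sum.cong) (auto simp: weak_compositions_def insert_ones_Suc)
    then show ?thesis
      using True Cons.IH[where n = n and f = "\<lambda>ks. f (Suc (hd ks) # tl ks)"] k by simp
  next
    case False
    then show ?thesis
      using Cons.IH[where n = "n - j" and f = "\<lambda>ks. f (1 # replicate j 1 @ ks)" for j] k
      by (simp add: sum_weak_compositions_Suc insert_ones_Cons index_of_word_replicate_False_append)
  qed
qed

section \<open>The left-hand side of (A): concatenated blocks\<close>

definition block_compositions :: "nat list \<Rightarrow> nat list \<Rightarrow> nat list list set" where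
  "block_compositions ks ms = {as. length as = length ks \<and>
     (\<forall>i<length ks. as ! i \<in> compositions (ms ! i) (ks ! i + ms ! i - 1))}"

text \<open>The function \<open>f\<close> is arbitrary because inductions absorb the leading part of
  the index into it.\<close>

definition block_sum :: "nat list \<Rightarrow> nat \<Rightarrow> (nat list \<Rightarrow> real) \<Rightarrow> real" where
  "block_sum ks t f =
     (\<Sum>ms\<in>compositions (length ks) (length ks + t). \<Sum>as\<in>block_compositions ks ms. f (concat as))"

lemma block_compositions_Cons:
  "block_compositions (k # ks) (m # ms) =
     (\<lambda>(a, as). a # as) ` (compositions m (k + m - 1) \<times> block_compositions ks ms)"
proof -
  have "as \<in> block_compositions (k # ks) (m # ms) \<longleftrightarrow>
      (\<exists>b bs. as = b # bs \<and> b \<in> compositions m (k + m - 1) \<and> bs \<in> block_compositions ks ms)" for as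
    by (cases as) (auto simp: block_compositions_def All_less_Suc2)
  then show ?thesis by auto
qed

lemma block_sum_Nil: "block_sum [] t f = (if t = 0 then f [] else 0)"
  by (simp add: block_sum_def block_compositions_def compositions_0)

lemma block_sum_Cons:
  "block_sum (k # ks) t f =
     (\<Sum>j\<le>t. \<Sum>a\<in>compositions (Suc j) (k + j). block_sum ks (t - j) (\<lambda>v. f (a @ v)))"
proof -
  have inj: "inj_on (\<lambda>(a, as). a # as) X" for X :: "(nat list \<times> nat list list) set"
    by (auto simp: inj_on_def)
  have "(\<Sum>as\<in>block_compositions (k # ks) (Suc j # ms). f (concat as)) =
      (\<Sum>a\<in>compositions (Suc j) (k + j). \<Sum>as\<in>block_compositions ks ms. f (a @ concat as))" for j ms
    unfolding block_compositions_Cons sum.reindex[OF inj] sum.cartesian_product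
    by (simp add: case_prod_unfold)
  then have "block_sum (k # ks) t f = (\<Sum>j\<le>t. \<Sum>ms\<in>compositions (length ks) (length ks + (t - j)).
      \<Sum>a\<in>compositions (Suc j) (k + j). \<Sum>as\<in>block_compositions ks ms. f (a @ concat as))"
    unfolding block_sum_def list.size(4) add_0_right add_Suc_right sum_compositions_Suc by simp
  also have "\<dots> = (\<Sum>j\<le>t. \<Sum>a\<in>compositions (Suc j) (k + j). block_sum ks (t - j) (\<lambda>v. f (a @ v)))"
    unfolding block_sum_def by (intro sum.cong refl sum.swap)
  finally show ?thesis .
qed

text \<open>A block of depth \<open>m\<close> and weight \<open>k + m - 1\<close> is a word with
  \<open>k - 1\<close> pluses and \<open>m - 1\<close> commas, that is, the run of the entry
  \<open>k\<close> with \<open>m - 1\<close> commas inserted at arbitrary places.\<close>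

lemma block_sum_index_of_word:
  "block_sum (index_of_word w) t f = insert_commas_sum w t (\<lambda>v. f (index_of_word v))"
proof (induction w arbitrary: t f)
  case Nil
  have "block_sum [1] t f = (\<Sum>j\<le>t. if j = t then f (replicate (Suc t) 1) else 0)"
    unfolding block_sum_Cons
    by (rule sum.cong) (auto simp: block_sum_Nil compositions_all_ones)
  then show ?case
    using index_of_word_replicate_False_append[of t "[]"] by (simp add: replicate_append_same)
next
  case (Cons a w)
  show ?case
  proof (cases a)
    case False
    have "block_sum (1 # index_of_word w) t f =
        (\<Sum>j\<le>t. block_sum (index_of_word w) (t - j) (\<lambda>v. f (replicate (Suc j) 1 @ v)))"
      unfolding block_sum_Cons by (simp add: compositions_all_ones)
    then show ?thesis
      using False Cons.IH
      by (simp add: index_of_word_replicate_False_append replicate_app_Cons_same)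
  next
    case True
    obtain k ks where k: "index_of_word w = k # ks" by (cases "index_of_word w") auto
    then have "1 \<le> k" using index_index_of_word[of w] by (simp add: index_def)
    \<comment> \<open>The \<open>i\<close> leading ones are the commas inserted before the first
      plus; removing them and that plus leaves a block for the entry \<open>k\<close>.\<close>
    let ?g = "\<lambda>i v. f (replicate i 1 @ Suc (hd v) # tl v)"
    have "block_sum (Suc k # ks) t f =
        (\<Sum>j\<le>t. \<Sum>i\<le>j. \<Sum>a\<in>compositions (Suc (j - i)) (k + (j - i)).
           block_sum ks (t - j) (\<lambda>v. f (replicate i 1 @ Suc (hd a) # tl a @ v)))"
      unfolding block_sum_Cons sum_compositions_leading_ones[OF \<open>1 \<le> k\<close>] by simp
    also have "\<dots> = (\<Sum>i\<le>t. \<Sum>j\<le>t - i. \<Sum>a\<in>compositions (Suc j) (k + j).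
           block_sum ks (t - i - j) (\<lambda>v. f (replicate i 1 @ Suc (hd a) # tl a @ v)))"
      by (subst sum_triangle_shift) simp
    also have "\<dots> = (\<Sum>i\<le>t. block_sum (k # ks) (t - i) (?g i))"
      unfolding block_sum_Cons
    proof (intro sum.cong refl)
      fix i j a assume "a \<in> compositions (Suc j) (k + j)"
      then have "a \<noteq> []" by (auto simp: compositions_def)
      then show "block_sum ks (t - i - j) (\<lambda>v. f (replicate i 1 @ Suc (hd a) # tl a @ v)) =
          block_sum ks (t - i - j) (\<lambda>v. ?g i (a @ v))"
        by simp
    qed
    also have "\<dots> = insert_commas_sum (True # w) t (\<lambda>v. f (index_of_word v))"
      using Cons.IH k by (simp add: index_of_word_replicate_False_append)
    finally show ?thesis using True k by simp
  qed
qed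

text \<open>Gives the left-hand side of (A) the shape of its right-hand side, with the dual sum of
  (B) in place of the plain one.\<close>

lemma block_sum_eq_sum_hoffman_dual:
  assumes "index ks" "ks \<noteq> []"
  shows "block_sum ks t f =
    (\<Sum>l=0..t. \<Sum>ms\<in>weak_compositions (length ks - 1) (t - l).
       \<Sum>es\<in>weak_compositions (length (hoffman_dual (insert_ones ks ms))) l.
         f (hoffman_dual (tuple_add (hoffman_dual (insert_ones ks ms)) es)))"
proof -
  obtain w where w: "index_of_word w = ks" using ex_index_of_word[OF assms] by blast
  show ?thesis
    unfolding w[symmetric] block_sum_index_of_word insert_commas_sum_eq
      sum_insert_ones_index_of_word[where f = "\<lambda>ks. \<Sum>es\<in>weak_compositions (length (hoffman_dual ks)) _.
        f (hoffman_dual (tuple_add (hoffman_dual ks) es))"]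
      sum_hoffman_dual_index_of_word
    by (simp add: atMost_atLeast0)
qed

section \<open>The equivalence of (A) and (B)\<close>

theorem theorem3p3:
  shows
   "(\<forall>(r::nat) (ks::nat list) (t::nat). 1 \<le> r \<and> length ks = r \<and> index ks \<longrightarrow>
       (\<Sum>ms \<in> compositions r (r + t).
          \<Sum>as \<in> {as. length as = r \<and>
                     (\<forall>i<r. as ! i \<in> compositions (ms ! i) (ks ! i + ms ! i - 1))}.
            mzv_plus (concat as))
       = (\<Sum>l=0..t. \<Sum>ms \<in> weak_compositions (r - 1) (t - l).
            \<Sum>es \<in> weak_compositions (length (insert_ones ks ms)) l.
              mzv_plus (tuple_add (insert_ones ks ms) es)))
    \<longleftrightarrow>
    (\<forall>(r::nat) (ks::nat list) (l::nat). 1 \<le> r \<and> length ks = r \<and> index ks \<longrightarrow>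
       (\<Sum>es \<in> weak_compositions (length ks) l. mzv_plus (tuple_add ks es))
       = (\<Sum>es' \<in> weak_compositions (length (hoffman_dual ks)) l.
            mzv_plus (hoffman_dual (tuple_add (hoffman_dual ks) es'))))"
proof -
  \<comment> \<open>\<open>F\<close> and \<open>G\<close> are the two sides of (B), and
    \<open>A\<close> is (A) with its left-hand side rewritten through \<open>G\<close>.\<close>
  define F where "F ks l = (\<Sum>es\<in>weak_compositions (length ks) l. mzv_plus (tuple_add ks es))"
    for ks l
  define G where "G ks l = (\<Sum>es\<in>weak_compositions (length (hoffman_dual ks)) l.
      mzv_plus (hoffman_dual (tuple_add (hoffman_dual ks) es)))" for ks l
  define A where "A ks t \<longleftrightarrow>
      (\<Sum>l=0..t. \<Sum>ms\<in>weak_compositions (length ks - 1) (t - l). G (insert_ones ks ms) l) =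
      (\<Sum>l=0..t. \<Sum>ms\<in>weak_compositions (length ks - 1) (t - l). F (insert_ones ks ms) l)" for ks t
  have lhs: "(\<Sum>ms \<in> compositions (length ks) (length ks + t).
        \<Sum>as \<in> {as. length as = length ks \<and>
                   (\<forall>i<length ks. as ! i \<in> compositions (ms ! i) (ks ! i + ms ! i - 1))}.
          mzv_plus (concat as)) =
      (\<Sum>l=0..t. \<Sum>ms\<in>weak_compositions (length ks - 1) (t - l). G (insert_ones ks ms) l)"
    if "ks \<noteq> []" "index ks" for ks t
    using block_sum_eq_sum_hoffman_dual[of ks t mzv_plus] that
    by (simp add: block_sum_def block_compositions_def G_def)
  have ins: "index (insert_ones ks ms)" "insert_ones ks ms \<noteq> []" if "index ks" "ks \<noteq> []" for ks ms
    using index_insert_ones that by (auto simp: insert_ones_def)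
  have "(\<forall>ks t. ks \<noteq> [] \<and> index ks \<longrightarrow> A ks t) \<longleftrightarrow>
      (\<forall>ks l. ks \<noteq> [] \<and> index ks \<longrightarrow> F ks l = G ks l)"
  proof (intro iffI allI impI)
    fix ks t assume "\<forall>ks l. ks \<noteq> [] \<and> index ks \<longrightarrow> F ks l = G ks l" "ks \<noteq> [] \<and> index ks"
    then show "A ks t" unfolding A_def using ins by auto
  next
    fix ks l assume A: "\<forall>ks t. ks \<noteq> [] \<and> index ks \<longrightarrow> A ks t" and "ks \<noteq> [] \<and> index ks"
    from this(2) show "F ks l = G ks l"
    \<comment> \<open>The index must vary, since the summands of (A) with \<open>j < l\<close>
      concern the longer indices \<open>insert_ones ks ms\<close>; cancelling them leaves (B) for
      \<open>ks\<close> and \<open>l\<close>.\<close>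
    proof (induction l arbitrary: ks rule: less_induct)
      case (less l)
      have top: "(\<Sum>j=0..l. \<Sum>ms\<in>weak_compositions (length ks - 1) (l - j). H (insert_ones ks ms) j) =
          H ks l + (\<Sum>j=0..<l. \<Sum>ms\<in>weak_compositions (length ks - 1) (l - j). H (insert_ones ks ms) j)"
        for H :: "nat list \<Rightarrow> nat \<Rightarrow> real"
        using less.prems insert_ones_replicate_0[of ks]
        by (simp add: sum.last_plus weak_compositions_zero_sum
            flip: atLeastLessThanSuc_atLeastAtMost)
      have "(\<Sum>j=0..<l. \<Sum>ms\<in>weak_compositions (length ks - 1) (l - j). F (insert_ones ks ms) j) =
          (\<Sum>j=0..<l. \<Sum>ms\<in>weak_compositions (length ks - 1) (l - j). G (insert_ones ks ms) j)"
        using less ins by (intro sum.cong refl) auto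
      moreover have "A ks l" using A less.prems by blast
      ultimately show ?case unfolding A_def top by simp
    qed
  qed
  moreover have "Suc 0 \<le> length ks \<longleftrightarrow> ks \<noteq> []" for ks :: "nat list"
    by (cases ks) auto
  ultimately show ?thesis
    by (simp add: A_def lhs[unfolded One_nat_def] flip: F_def G_def cong: conj_cong imp_cong)
qed

end
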